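(* Let $\|\cdot\|_E$ be an absolute, normalised norm on $\mathbb{R}^2$ which is Gâteaux-differentiable at $(0,1)$ and at $(1,0)$. Let $X$ and $Y$ be real Banach spaces with the ball generated property (BGP). Then $X\oplus_E Y$ also has the BGP.
   Context: All Banach spaces are real. A norm $\|\cdot\|_E$ on $\mathbb{R}^2$ is called absolute if $\|(a,b)\|_E=\|(|a|,|b|)\|_E$ for all $(a,b)\in\mathbb{R}^2$, and normalised if $\|(1,0)\|_E=\|(0,1)\|_E=1$. For Banach spaces $X$ and $Y$, $X\oplus_E Y$ denotes the space $X\times Y$ endowed with the norm $\|(x,y)\|_E:=\|(\|x\|,\|y\|)\|_E$; it is a Banach space. For a Banach space $X$, $x\in X$ and $r>0$, $B_r(x)$ denotes the closed ball with center $x$ and radius $r$. $X$ has the ball generated property (BGP) if every closed, bounded, convex subset $C\subseteq X$ is ball generated, i.e. can be written as an intersection of finite unions of closed balls: there exists $\mathcal{A}\subseteq\mathcal{B}$ with $\bigcap\mathcal{A}=C$, where $\mathcal{B}:=\{\bigcup_{i=1}^n B_{r_i}(x_i): n\in\mathbb{N},\ r_1,\dots,r_n>0,\ x_1,\dots,x_n\in X\}$. *)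

theory Defs
  imports "HOL-Analysis.Analysis"
begin

text \<open>
  The norm of \<open>X \<oplus>\<^sub>E Y\<close> differs from the norm that the type class instance puts on
  product types. Norms are therefore passed as explicit functions, and balls, boundedness and
  closedness are those of the induced metric.
\<close>

definition is_norm :: "('v::real_vector \<Rightarrow> real) \<Rightarrow> bool" where
  "is_norm N \<longleftrightarrow>
     (\<forall>x. N x = 0 \<longleftrightarrow> x = 0) \<and>
     (\<forall>c x. N (c *\<^sub>R x) = \<bar>c\<bar> * N x) \<and>
     (\<forall>x y. N (x + y) \<le> N x + N y)"

definition norm_dist :: "('v::real_vector \<Rightarrow> real) \<Rightarrow> 'v \<Rightarrow> 'v \<Rightarrow> real" where
  "norm_dist N x y = N (x - y)"

definition absolute :: "(real \<times> real \<Rightarrow> real) \<Rightarrow> bool" where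
  "absolute E \<longleftrightarrow> (\<forall>a b. E (a, b) = E (\<bar>a\<bar>, \<bar>b\<bar>))"

definition normalised :: "(real \<times> real \<Rightarrow> real) \<Rightarrow> bool" where
  "normalised E \<longleftrightarrow> E (1, 0) = 1 \<and> E (0, 1) = 1"

definition gateaux_differentiable_at ::
    "('v::real_normed_vector \<Rightarrow> real) \<Rightarrow> 'v \<Rightarrow> bool" where
  "gateaux_differentiable_at f x \<longleftrightarrow>
     (\<exists>D. bounded_linear D \<and>
        (\<forall>h. ((\<lambda>t. (f (x + t *\<^sub>R h) - f x) / t) \<longlongrightarrow> D h) (at 0)))"

definition sum_norm ::
    "(real \<times> real \<Rightarrow> real) \<Rightarrow> 'a::real_normed_vector \<times> 'b::real_normed_vector \<Rightarrow> real" where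
  "sum_norm E p = E (norm (fst p), norm (snd p))"

text \<open>
  The case \<open>n = 0\<close> (the empty union) is allowed. It only matters for the empty set in the
  zero space: in any other space there are two disjoint balls.
\<close>

definition finite_ball_unions :: "('v::real_vector \<Rightarrow> real) \<Rightarrow> 'v set set" where
  "finite_ball_unions N =
     {\<Union>i\<in>{1..n}. Metric_space.mcball UNIV (norm_dist N) (x i) (r i) | (n::nat) x r.
        \<forall>i\<in>{1..n}. r i > 0}"

definition ball_generated :: "('v::real_vector \<Rightarrow> real) \<Rightarrow> 'v set \<Rightarrow> bool" where
  "ball_generated N C \<longleftrightarrow> (\<exists>\<A>. \<A> \<subseteq> finite_ball_unions N \<and> \<Inter>\<A> = C)"

definition BGP :: "('v::real_vector \<Rightarrow> real) \<Rightarrow> bool" where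
  "BGP N \<longleftrightarrow>
     (\<forall>C. closedin (Metric_space.mtopology UNIV (norm_dist N)) C \<and>
          Metric_space.mbounded UNIV (norm_dist N) C \<and> convex C
        \<longrightarrow> ball_generated N C)"

lemma is_norm_nonneg:
  assumes "is_norm N" shows "0 \<le> N x"
proof -
  have "N (x + (-1) *\<^sub>R x) \<le> N x + N ((-1) *\<^sub>R x)" "N ((-1) *\<^sub>R x) = \<bar>-1\<bar> * N x" "N 0 = 0"
    using assms unfolding is_norm_def by blast+
  then show ?thesis by simp
qed

lemma Metric_space_norm_dist:
  assumes "is_norm N" shows "Metric_space UNIV (norm_dist N)"
proof
  fix x y z
  show "0 \<le> norm_dist N x y"
    using is_norm_nonneg[OF assms] by (simp add: norm_dist_def)
  have "N (y - x) = N ((-1) *\<^sub>R (x - y))" by simp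
  also have "\<dots> = \<bar>-1\<bar> * N (x - y)" using assms unfolding is_norm_def by blast
  finally show "norm_dist N x y = norm_dist N y x" by (simp add: norm_dist_def)
  show "norm_dist N x y = 0 \<longleftrightarrow> x = y"
    using assms by (simp add: norm_dist_def is_norm_def)
  have "N ((x - y) + (y - z)) \<le> N (x - y) + N (y - z)"
    using assms unfolding is_norm_def by blast
  then show "norm_dist N x z \<le> norm_dist N x y + norm_dist N y z"
    by (simp add: norm_dist_def)
qed

lemma absolute_norm_mono_fst:
  assumes "is_norm E" "absolute E" "0 \<le> a" "a \<le> c"
  shows "E (a, b) \<le> E (c, b)"
proof (cases "c = 0")
  case False
  then have c: "c > 0" using assms by simp
  define s where "s = (c + a) / (2 * c)"
  define t where "t = (c - a) / (2 * c)"
  have st: "0 \<le> s" "0 \<le> t" "s + t = 1" "(s - t) * c = a"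
    using c assms by (auto simp: s_def t_def field_simps)
  have "s * c + t * - c = a" using st(4) by (simp add: algebra_simps)
  moreover have "s * b + t * b = b" using st(3) by (metis distrib_right mult_1)
  ultimately have "(a, b) = s *\<^sub>R (c, b) + t *\<^sub>R (- c, b)" by simp
  also have "E \<dots> \<le> E (s *\<^sub>R (c, b)) + E (t *\<^sub>R (- c, b))"
    using assms(1) unfolding is_norm_def by blast
  also have "\<dots> = \<bar>s\<bar> * E (c, b) + \<bar>t\<bar> * E (- c, b)"
    using assms(1) unfolding is_norm_def by metis
  also have "E (- c, b) = E (c, b)"
    using assms(2) unfolding absolute_def by (metis abs_minus_cancel)
  also have "\<bar>s\<bar> * E (c, b) + \<bar>t\<bar> * E (c, b) = E (c, b)"
    using st by (metis abs_of_nonneg distrib_right mult_1)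
  finally show ?thesis .
qed (use assms in simp)

lemma absolute_norm_mono_snd:
  assumes "is_norm E" "absolute E" "0 \<le> b" "b \<le> d"
  shows "E (a, b) \<le> E (a, d)"
proof -
  define F where "F = (\<lambda>(u, v). E (v, u))"
  have "F p = 0 \<longleftrightarrow> p = 0" "F (k *\<^sub>R p) = \<bar>k\<bar> * F p" "F (p + q) \<le> F p + F q" for k p q
  proof -
    have 1: "F p = E (snd p, fst p)" for p by (simp add: F_def split_beta)
    show "F p = 0 \<longleftrightarrow> p = 0"
      using assms(1) by (auto simp: 1 is_norm_def prod_eq_iff)
    have "E (k *\<^sub>R (snd p, fst p)) = \<bar>k\<bar> * E (snd p, fst p)"
      using assms(1) unfolding is_norm_def by blast
    then show "F (k *\<^sub>R p) = \<bar>k\<bar> * F p" by (simp add: 1)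
    have "E ((snd p, fst p) + (snd q, fst q)) \<le> E (snd p, fst p) + E (snd q, fst q)"
      using assms(1) unfolding is_norm_def by blast
    then show "F (p + q) \<le> F p + F q" by (simp add: 1)
  qed
  then have "is_norm F" by (simp add: is_norm_def)
  moreover have "absolute F" using assms(2) by (simp add: absolute_def F_def)
  ultimately have "F (b, a) \<le> F (d, a)" using assms by (intro absolute_norm_mono_fst)
  then show ?thesis by (simp add: F_def)
qed

lemma is_norm_sum_norm:
  assumes "is_norm E" "absolute E"
  shows "is_norm (sum_norm E :: 'a::real_normed_vector \<times> 'b::real_normed_vector \<Rightarrow> real)"
  unfolding is_norm_def
proof (intro conjI allI)
  fix c :: real and p q :: "'a \<times> 'b"
  show "sum_norm E p = 0 \<longleftrightarrow> p = 0"
    using assms(1) by (auto simp: is_norm_def sum_norm_def prod_eq_iff)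
  have "E (\<bar>c\<bar> *\<^sub>R (norm (fst p), norm (snd p))) = \<bar>\<bar>c\<bar>\<bar> * E (norm (fst p), norm (snd p))"
    using assms(1) unfolding is_norm_def by blast
  then show "sum_norm E (c *\<^sub>R p) = \<bar>c\<bar> * sum_norm E p" by (simp add: sum_norm_def)
  have "sum_norm E (p + q) \<le> E (norm (fst p) + norm (fst q), norm (snd (p + q)))"
    unfolding sum_norm_def
    by (rule absolute_norm_mono_fst[OF assms]) (auto intro: norm_triangle_ineq)
  also have "\<dots> \<le> E (norm (fst p) + norm (fst q), norm (snd p) + norm (snd q))"
    by (rule absolute_norm_mono_snd[OF assms]) (auto intro: norm_triangle_ineq)
  also have "\<dots> = E ((norm (fst p), norm (snd p)) + (norm (fst q), norm (snd q)))" by simp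
  also have "\<dots> \<le> sum_norm E p + sum_norm E q"
    using assms(1) unfolding is_norm_def sum_norm_def by blast
  finally show "sum_norm E (p + q) \<le> sum_norm E p + sum_norm E q" .
qed

lemma norm_dist_norm: "norm_dist norm = dist"
  by (simp add: fun_eq_iff norm_dist_def dist_norm)

lemma BGP_norm_iff:
  "BGP (norm :: 'a::real_normed_vector \<Rightarrow> real) \<longleftrightarrow>
     (\<forall>C::'a set. closed C \<and> bounded C \<and> convex C \<longrightarrow>
        (\<exists>\<A>. \<A> \<subseteq> {\<Union>i\<in>{1..n}. cball (x i) (r i) | (n::nat) x r. \<forall>i\<in>{1..n}. r i > 0} \<and>
             \<Inter>\<A> = C))"
  by (simp add: BGP_def ball_generated_def finite_ball_unions_def norm_dist_norm)

end

theory Submission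
  imports Defs
begin

text \<open>
  Let \<open>z = (x, y)\<close> lie outside a closed bounded convex set \<open>C\<close>, and separate it strictly from \<open>C\<close>
  by a functional \<open>f\<close>. Every \<open>(u, v) \<in> C\<close> then satisfies \<open>f (u - x, 0) \<ge> \<delta>\<close> or
  \<open>f (0, v - y) \<ge> \<delta>\<close>. By the BGP of the first factor, the \<open>u\<close> of the first kind are covered by
  finitely many balls of \<open>X\<close> that miss \<open>x\<close>. Moving the centre of such a ball
  away from \<open>x\<close>, while increasing the radius by the same amount, enlarges the ball and keeps its
  distance to \<open>x\<close>. Differentiability at \<open>(1, 0)\<close> means that \<open>E (s, K) - s\<close> tends to \<open>0\<close> as
  \<open>s\<close> grows, so a sufficiently large ball, centred at height \<open>y\<close>, covers all the corresponding
  \<open>(u, v)\<close> and still misses \<open>(x, y)\<close>. The second kind is treated symmetrically.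
\<close>

section \<open>Sublinear functionals and separation\<close>

definition sublinear :: "('v::real_vector \<Rightarrow> real) \<Rightarrow> bool" where
  "sublinear p \<longleftrightarrow> (\<forall>x y. p (x + y) \<le> p x + p y) \<and> (\<forall>c x. 0 < c \<longrightarrow> p (c *\<^sub>R x) = c * p x)"

text \<open>Applying the second inequality to \<open>inverse c\<close> and
  \<open>c *\<^sub>R x\<close> yields its reverse. For functionals defined as infima this leaves one
  easy inequality to check.\<close>

lemma sublinearI:
  assumes "\<And>x y. p (x + y) \<le> p x + p y"
    and "\<And>c x. 0 < c \<Longrightarrow> p (c *\<^sub>R x) \<le> c * p x"
  shows "sublinear p"
proof -
  have "c * p x \<le> p (c *\<^sub>R x)" if "0 < c" for c x
  proof -
    have "p (inverse c *\<^sub>R (c *\<^sub>R x)) \<le> inverse c * p (c *\<^sub>R x)"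
      using that by (intro assms) auto
    then show ?thesis using that by (simp add: field_simps)
  qed
  then show ?thesis
    unfolding sublinear_def using assms by (auto intro: antisym)
qed

lemma sublinear_add: "sublinear p \<Longrightarrow> p (x + y) \<le> p x + p y"
  by (simp add: sublinear_def)

lemma sublinear_scaleR: "sublinear p \<Longrightarrow> 0 < c \<Longrightarrow> p (c *\<^sub>R x) = c * p x"
  by (simp add: sublinear_def)

lemma sublinear_zero:
  assumes "sublinear p" shows "p 0 = 0"
  using sublinear_scaleR[OF assms, of 2 0] by simp

lemma sublinear_minus:
  assumes "sublinear p" shows "- p (- x) \<le> p x"
  using sublinear_add[OF assms, of x "- x"] sublinear_zero[OF assms] by simp

text \<open>Supplies the lower bounds for Zorn's lemma. The common bound \<open>p\<close> keeps the
  infimum finite, since \<open>- p (- x) \<le> q x\<close> for every member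
  \<open>q\<close>.\<close>

lemma sublinear_Inf_chain:
  assumes ne: "\<C> \<noteq> {}" and chain: "\<And>q r. q \<in> \<C> \<Longrightarrow> r \<in> \<C> \<Longrightarrow> q \<le> r \<or> r \<le> q"
    and sub: "\<And>q. q \<in> \<C> \<Longrightarrow> sublinear q" and le: "\<And>q. q \<in> \<C> \<Longrightarrow> q \<le> p"
  shows "sublinear (\<lambda>x. INF q\<in>\<C>. q x)" and "\<And>q. q \<in> \<C> \<Longrightarrow> (\<lambda>x. INF q\<in>\<C>. q x) \<le> q"
proof -
  have bdd: "bdd_below ((\<lambda>q. q x) ` \<C>)" for x
  proof (rule bdd_belowI2)
    fix q assume q: "q \<in> \<C>"
    show "- p (- x) \<le> q x"
      using sublinear_minus[OF sub[OF q], of x] le_funD[OF le[OF q], of "- x"] by linarith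
  qed
  show low: "(\<lambda>x. INF q\<in>\<C>. q x) \<le> q" if "q \<in> \<C>" for q
    by (rule le_funI) (rule cINF_lower[OF bdd that])
  show "sublinear (\<lambda>x. INF q\<in>\<C>. q x)"
  proof (rule sublinearI)
    fix x y
    have "(INF q\<in>\<C>. q (x + y)) - r y \<le> q x" if qr: "q \<in> \<C>" "r \<in> \<C>" for q r
    proof -
      \<comment> \<open>The smaller of \<open>q\<close> and \<open>r\<close> serves both points at
        once; this is how comparability in the chain gives subadditivity.\<close>
      obtain s where s: "s \<in> \<C>" "s \<le> q" "s \<le> r"
        using chain[OF qr] qr by blast
      have "(INF q\<in>\<C>. q (x + y)) \<le> s (x + y)" using low[OF s(1)] by (rule le_funD)
      also have "\<dots> \<le> s x + s y" by (rule sublinear_add[OF sub[OF s(1)]])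
      also have "\<dots> \<le> q x + r y" using s by (intro add_mono) (auto dest: le_funD)
      finally show ?thesis by simp
    qed
    then have "(INF q\<in>\<C>. q (x + y)) - r y \<le> (INF q\<in>\<C>. q x)" if "r \<in> \<C>" for r
      using that by (intro cINF_greatest[OF ne])
    then have "(INF q\<in>\<C>. q (x + y)) - (INF q\<in>\<C>. q x) \<le> r y" if "r \<in> \<C>" for r
      using that by (smt (verit))
    then have "(INF q\<in>\<C>. q (x + y)) - (INF q\<in>\<C>. q x) \<le> (INF r\<in>\<C>. r y)"
      by (intro cINF_greatest[OF ne])
    then show "(INF q\<in>\<C>. q (x + y)) \<le> (INF q\<in>\<C>. q x) + (INF q\<in>\<C>. q y)" by simp
  next
    fix c :: real and x assume c: "0 < c"
    have "inverse c * (INF q\<in>\<C>. q (c *\<^sub>R x)) \<le> q x" if "q \<in> \<C>" for q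
      using le_funD[OF low[OF that], of "c *\<^sub>R x"] sublinear_scaleR[OF sub[OF that] c] c
      by (simp add: field_simps)
    then have "inverse c * (INF q\<in>\<C>. q (c *\<^sub>R x)) \<le> (INF q\<in>\<C>. q x)"
      by (intro cINF_greatest[OF ne])
    then show "(INF q\<in>\<C>. q (c *\<^sub>R x)) \<le> c * (INF q\<in>\<C>. q x)"
      using c by (simp add: field_simps)
  qed
qed

text \<open>Zorn's lemma for the reversed pointwise order below \<open>p\<close>. Minimality holds
  among all sublinear functionals, as anything below \<open>q\<close> is also below
  \<open>p\<close>.\<close>

lemma minimal_sublinear_exists:
  assumes "sublinear p"
  obtains q where "sublinear q" "q \<le> p" "\<And>r. sublinear r \<Longrightarrow> r \<le> q \<Longrightarrow> r = q"
proof -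
  define A where "A = {q. sublinear q \<and> q \<le> p}"
  have "\<exists>m\<in>A. \<forall>a\<in>A. a \<le> m \<longrightarrow> a = m"
  proof (rule predicate_Zorn[where P = "(\<ge>)"])
    show "partial_order_on A (relation_of (\<ge>) A)"
      by (rule partial_order_on_relation_ofI) auto
    fix \<C> assume "\<C> \<in> Chains (relation_of (\<ge>) A)"
    then have C: "\<C> \<subseteq> A" "\<And>q r. q \<in> \<C> \<Longrightarrow> r \<in> \<C> \<Longrightarrow> q \<le> r \<or> r \<le> q"
      by (auto simp: Chains_def relation_of_def)
    show "\<exists>u\<in>A. \<forall>a\<in>\<C>. u \<le> a"
    proof (cases "\<C> = {}")
      case True
      then show ?thesis using assms by (auto simp: A_def)
    next
      case False
      have "sublinear (\<lambda>x. INF q\<in>\<C>. q x)" "\<And>q. q \<in> \<C> \<Longrightarrow> (\<lambda>x. INF q\<in>\<C>. q x) \<le> q"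
        using sublinear_Inf_chain[OF False C(2), of p] C(1) by (auto simp: A_def)
      moreover obtain q where "q \<in> \<C>" using False by blast
      ultimately show ?thesis
        using C(1) by (intro bexI[of _ "\<lambda>x. INF q\<in>\<C>. q x"]) (auto simp: A_def intro: order_trans)
    qed
  qed
  then obtain q where "q \<in> A" "\<And>a. a \<in> A \<Longrightarrow> a \<le> q \<Longrightarrow> a = q" by blast
  then show ?thesis
    by (intro that[of q]) (auto simp: A_def intro: order_trans)
qed

text \<open>
  With a singleton \<open>C\<close> this shows that minimal sublinear functionals are linear; with the norm
  as \<open>p\<close> it yields a separating functional.
\<close>

lemma sublinear_Inf_convex:
  fixes p :: "'v::real_vector \<Rightarrow> real"
  assumes p: "sublinear p" and C: "convex C" "C \<noteq> {}" and d: "\<And>c. c \<in> C \<Longrightarrow> d \<le> p c"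
  defines "q \<equiv> \<lambda>z. INF (t, c)\<in>{0..} \<times> C. p (z + t *\<^sub>R c) - t * d"
  shows "sublinear q" and "q \<le> p" and "\<And>c. c \<in> C \<Longrightarrow> q (- c) \<le> - d"
proof -
  \<comment> \<open>The lower bound \<open>- p (- z)\<close> is independent of \<open>t\<close> and
    \<open>c\<close>, because \<open>d \<le> p c\<close> absorbs the subtracted
    \<open>t * d\<close>.\<close>
  have bdd: "bdd_below ((\<lambda>(t, c). p (z + t *\<^sub>R c) - t * d) ` ({0..} \<times> C))" for z
  proof (rule bdd_belowI2, clarsimp)
    fix t :: real and c assume t: "0 \<le> t" and c: "c \<in> C"
    have "t * d \<le> p (t *\<^sub>R c)"
      using d[OF c] t sublinear_scaleR[OF p, of t c] sublinear_zero[OF p]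
      by (cases "t = 0") (auto intro: mult_left_mono)
    also have "\<dots> \<le> p (- z) + p (z + t *\<^sub>R c)"
      using sublinear_add[OF p, of "- z" "z + t *\<^sub>R c"] by simp
    finally show "- p (- z) \<le> p (z + t *\<^sub>R c) - t * d" by linarith
  qed
  have ne: "{0::real..} \<times> C \<noteq> {}" using C by auto
  have low: "q z \<le> p (z + t *\<^sub>R c) - t * d" if "0 \<le> t" "c \<in> C" for z t c
    unfolding q_def using cINF_lower[OF bdd, of "(t, c)" z] that by auto
  have great: "m \<le> q z" if "\<And>t c. 0 \<le> t \<Longrightarrow> c \<in> C \<Longrightarrow> m \<le> p (z + t *\<^sub>R c) - t * d" for m z
    unfolding q_def using that by (intro cINF_greatest[OF ne]) auto
  obtain c0 where c0: "c0 \<in> C" using C by blast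
  show "q \<le> p" using low[of 0 c0] c0 by (auto intro: le_funI)
  show "q (- c) \<le> - d" if "c \<in> C" for c
    using low[of 1 c "- c"] that sublinear_zero[OF p] by simp
  show "sublinear q"
  proof (rule sublinearI)
    fix x y
    have *: "q (x + y) - (p (y + t *\<^sub>R b) - t * d) \<le> p (x + s *\<^sub>R a) - s * d"
      if st: "0 \<le> s" "a \<in> C" "0 \<le> t" "b \<in> C" for s t a b
    proof -
      \<comment> \<open>Convexity makes the cone over \<open>C\<close> closed under addition: the
        combination is \<open>s + t\<close> times a point of \<open>C\<close>.\<close>
      obtain c where c: "c \<in> C" "s *\<^sub>R a + t *\<^sub>R b = (s + t) *\<^sub>R c"
      proof (cases "s + t = 0")
        case True
        then have "s = 0" "t = 0" using st by auto
        then show ?thesis using st by (intro that[of a]) auto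
      next
        case False
        have "(s / (s + t)) *\<^sub>R a + (t / (s + t)) *\<^sub>R b \<in> C"
          using st False by (intro convexD[OF C(1)]) (auto simp: add_divide_distrib[symmetric])
        then show ?thesis using False by (intro that) (auto simp: scaleR_add_right)
      qed
      have "q (x + y) \<le> p ((x + y) + (s + t) *\<^sub>R c) - (s + t) * d"
        using that c by (intro low) auto
      also have "(x + y) + (s + t) *\<^sub>R c = (x + s *\<^sub>R a) + (y + t *\<^sub>R b)"
        using c(2) by (simp add: algebra_simps)
      also have "p \<dots> \<le> p (x + s *\<^sub>R a) + p (y + t *\<^sub>R b)" by (rule sublinear_add[OF p])
      finally show ?thesis by (simp add: algebra_simps)
    qed
    have "q (x + y) - (p (y + t *\<^sub>R b) - t * d) \<le> q x" if "0 \<le> t" "b \<in> C" for t b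
      by (rule great) (use * that in blast)
    then have "q (x + y) - q x \<le> q y"
      by (intro great) (smt (verit))
    then show "q (x + y) \<le> q x + q y" by simp
  next
    fix k :: real and x assume k: "0 < k"
    have "inverse k * q (k *\<^sub>R x) \<le> q x"
    proof (rule great)
      fix t :: real and c assume "0 \<le> t" "c \<in> C"
      then have "q (k *\<^sub>R x) \<le> p (k *\<^sub>R x + (k * t) *\<^sub>R c) - (k * t) * d"
        using k by (intro low) auto
      also have "k *\<^sub>R x + (k * t) *\<^sub>R c = k *\<^sub>R (x + t *\<^sub>R c)" by (simp add: scaleR_add_right)
      also have "p \<dots> = k * p (x + t *\<^sub>R c)" by (rule sublinear_scaleR[OF p k])
      finally show "inverse k * q (k *\<^sub>R x) \<le> p (x + t *\<^sub>R c) - t * d"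
        using k by (simp add: field_simps)
    qed
    then show "q (k *\<^sub>R x) \<le> k * q x" using k by (simp add: field_simps)
  qed
qed

text \<open>Lowering a minimal \<open>q\<close> to at most \<open>- q y\<close> at
  \<open>- y\<close> cannot change it, so \<open>q\<close> is odd. Oddness turns subadditivity into
  additivity and extends homogeneity to negative scalars.\<close>

theorem Hahn_Banach_sublinear:
  assumes "sublinear p"
  obtains f where "linear f" "f \<le> p"
proof -
  obtain q where q: "sublinear q" "q \<le> p" and min: "\<And>r. sublinear r \<Longrightarrow> r \<le> q \<Longrightarrow> r = q"
    using minimal_sublinear_exists[OF assms] by blast
  have odd: "q (- y) = - q y" for y
  proof -
    define r where "r = (\<lambda>z. INF (t, c)\<in>{0..} \<times> {y}. q (z + t *\<^sub>R c) - t * q y)"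
    have r: "sublinear r" "r \<le> q" "r (- y) \<le> - q y"
      unfolding r_def by (rule sublinear_Inf_convex[OF q(1)]; simp)+
    have "r = q" by (rule min[OF r(1,2)])
    then show ?thesis using r(3) sublinear_minus[OF q(1), of y] by simp
  qed
  have add: "q (x + y) = q x + q y" for x y
    using sublinear_add[OF q(1), of "x + y" "- y"] sublinear_add[OF q(1), of x y]
    by (simp add: odd)
  have "q (c *\<^sub>R x) = c * q x" for c x
  proof (cases c "0 :: real" rule: linorder_cases)
    case less
    then show ?thesis
      using sublinear_scaleR[OF q(1), of "- c" x] odd[of "c *\<^sub>R x"] by simp
  qed (simp_all add: sublinear_zero[OF q(1)] sublinear_scaleR[OF q(1)])
  then have "linear q" using add by (intro linearI) auto
  then show ?thesis using q(2) by (rule that)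
qed

text \<open>After translating \<open>z\<close> to the origin, the infimum functional
  \<open>q\<close> lies below \<open>N\<close> and is at most \<open>- d\<close> on the negated set,
  so any linear functional below \<open>q\<close> separates. The bound \<open>f \<le> N\<close> says
  that \<open>f\<close> has dual norm at most one.\<close>

lemma norm_separation:
  assumes N: "is_norm N" and C: "convex C" "C \<noteq> {}" and d: "\<And>c. c \<in> C \<Longrightarrow> d \<le> N (c - z)"
  obtains f where "linear f" "f \<le> N" "\<And>c. c \<in> C \<Longrightarrow> d \<le> f (c - z)"
proof -
  define K where "K = (\<lambda>c. c - z) ` C"
  have K: "convex K" "K \<noteq> {}" "\<And>c. c \<in> K \<Longrightarrow> d \<le> N c"
    using C d by (auto simp: K_def)
  have p: "sublinear N" using N by (simp add: is_norm_def sublinear_def)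
  define q where "q = (\<lambda>z. INF (t, c)\<in>{0..} \<times> K. N (z + t *\<^sub>R c) - t * d)"
  have q: "sublinear q" "q \<le> N" "\<And>c. c \<in> K \<Longrightarrow> q (- c) \<le> - d"
    unfolding q_def by (rule sublinear_Inf_convex[OF p K(1,2)]; use K(3) in simp)+
  obtain f where f: "linear f" "f \<le> q" using Hahn_Banach_sublinear[OF q(1)] by blast
  have "d \<le> f (c - z)" if "c \<in> C" for c
  proof -
    have "f (- (c - z)) \<le> q (- (c - z))" using f(2) by (rule le_funD)
    also have "\<dots> \<le> - d" using that by (intro q(3)) (simp add: K_def)
    finally show ?thesis using linear_neg[OF f(1), of "c - z"] by simp
  qed
  then show ?thesis using f q(2) by (intro that[of f]) auto
qed

section \<open>Finite unions of balls\<close>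

lemma mcball_norm_dist:
  assumes "is_norm N"
  shows "Metric_space.mcball UNIV (norm_dist N) x r = {z. N (x - z) \<le> r}"
  using Metric_space.mcball_def[OF Metric_space_norm_dist[OF assms]] by (simp add: norm_dist_def)

text \<open>Finite sets of centre-radius pairs replace the indexing by \<open>{1..n}\<close>, so
  that families of balls can be united and mapped without renumbering.\<close>

lemma finite_ball_unions_iff:
  assumes "is_norm N"
  shows "U \<in> finite_ball_unions N \<longleftrightarrow>
    (\<exists>S. finite S \<and> (\<forall>(x, r)\<in>S. r > 0) \<and> U = (\<Union>(x, r)\<in>S. {z. N (x - z) \<le> r}))"
    (is "_ \<longleftrightarrow> ?R")
proof
  assume "U \<in> finite_ball_unions N"
  then obtain n :: nat and x r where *: "\<forall>i\<in>{1..n}. r i > 0"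
      "U = (\<Union>i\<in>{1..n}. {z. N (x i - z) \<le> r i})"
    unfolding finite_ball_unions_def mcball_norm_dist[OF assms] by blast
  show ?R
    by (rule exI[of _ "(\<lambda>i. (x i, r i)) ` {1..n}"]) (use * in auto)
next
  assume ?R
  then obtain S where S: "finite S" "\<forall>(x, r)\<in>S. r > 0" "U = (\<Union>(x, r)\<in>S. {z. N (x - z) \<le> r})"
    by blast
  obtain h where "bij_betw h {1..card S} S"
    using ex_bij_betw_nat_finite_1[OF S(1)] by blast
  then have h: "h ` {1..card S} = S" by (simp add: bij_betw_def)
  have "U = (\<Union>s\<in>h ` {1..card S}. {z. N (fst s - z) \<le> snd s})"
    unfolding h using S(3) by (simp add: split_beta)
  then have "U = (\<Union>i\<in>{1..card S}. {z. N (fst (h i) - z) \<le> snd (h i)})"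
    by (simp only: image_image)
  moreover have "\<forall>i\<in>{1..card S}. snd (h i) > 0"
    using S(2) h by (force simp: split_beta)
  ultimately show "U \<in> finite_ball_unions N"
    unfolding finite_ball_unions_def mcball_norm_dist[OF assms] mem_Collect_eq
    by (intro exI[of _ "card S"] exI[of _ "\<lambda>i. fst (h i)"] exI[of _ "\<lambda>i. snd (h i)"] conjI)
qed

lemma finite_ball_unions_Un:
  assumes "is_norm N" "U \<in> finite_ball_unions N" "V \<in> finite_ball_unions N"
  shows "U \<union> V \<in> finite_ball_unions N"
proof -
  obtain S T where "finite S" "\<forall>(x, r)\<in>S. r > 0" "U = (\<Union>(x, r)\<in>S. {z. N (x - z) \<le> r})"
    "finite T" "\<forall>(x, r)\<in>T. r > 0" "V = (\<Union>(x, r)\<in>T. {z. N (x - z) \<le> r})"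
    using assms unfolding finite_ball_unions_iff[OF assms(1)] by blast
  then show ?thesis
    unfolding finite_ball_unions_iff[OF assms(1)] by (intro exI[of _ "S \<union> T"]) auto
qed

text \<open>Chooses one ball of the second norm for each ball of \<open>U\<close>. It is meant for a
  projection \<open>g\<close>, a strip \<open>B\<close> on which the other coordinate is bounded,
  and a point \<open>b\<close> to be avoided. The inclusion in \<open>U\<close> tells each single
  ball that it misses whatever \<open>U\<close> misses.\<close>

lemma finite_ball_unions_transfer:
  assumes N: "is_norm N" and M: "is_norm M" and U: "U \<in> finite_ball_unions N"
    and ball: "\<And>x r. 0 < r \<Longrightarrow> {z. N (x - z) \<le> r} \<subseteq> U \<Longrightarrow>
      \<exists>w \<rho>. 0 < \<rho> \<and> b \<notin> {z. M (w - z) \<le> \<rho>} \<and>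
        g -` {z. N (x - z) \<le> r} \<inter> B \<subseteq> {z. M (w - z) \<le> \<rho>}"
  obtains V where "V \<in> finite_ball_unions M" "b \<notin> V" "g -` U \<inter> B \<subseteq> V"
proof -
  obtain S where S: "finite S" "\<forall>(x, r)\<in>S. r > 0" "U = (\<Union>(x, r)\<in>S. {z. N (x - z) \<le> r})"
    using U unfolding finite_ball_unions_iff[OF N] by blast
  have "\<forall>s\<in>S. \<exists>t. 0 < snd t \<and> b \<notin> {z. M (fst t - z) \<le> snd t} \<and>
      g -` {z. N (fst s - z) \<le> snd s} \<inter> B \<subseteq> {z. M (fst t - z) \<le> snd t}"
  proof
    fix s assume s: "s \<in> S"
    have "0 < snd s" "{z. N (fst s - z) \<le> snd s} \<subseteq> U"
      using s S(2,3) by (force simp: split_beta)+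
    from ball[OF this] show "\<exists>t. 0 < snd t \<and> b \<notin> {z. M (fst t - z) \<le> snd t} \<and>
        g -` {z. N (fst s - z) \<le> snd s} \<inter> B \<subseteq> {z. M (fst t - z) \<le> snd t}"
      by auto
  qed
  from bchoice[OF this] obtain h where h: "\<forall>s\<in>S. 0 < snd (h s) \<and>
      b \<notin> {z. M (fst (h s) - z) \<le> snd (h s)} \<and>
      g -` {z. N (fst s - z) \<le> snd s} \<inter> B \<subseteq> {z. M (fst (h s) - z) \<le> snd (h s)}" ..
  define V where "V = (\<Union>(x, r)\<in>h ` S. {z. M (x - z) \<le> r})"
  have "V \<in> finite_ball_unions M"
    unfolding finite_ball_unions_iff[OF M] V_def
    using S(1) h by (intro exI[of _ "h ` S"]) auto
  moreover have "b \<notin> V" using h by (auto simp: V_def split_beta)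
  moreover have "g -` U \<inter> B \<subseteq> V"
  proof
    fix p assume p: "p \<in> g -` U \<inter> B"
    then obtain s where s: "s \<in> S" "p \<in> g -` {z. N (fst s - z) \<le> snd s} \<inter> B"
      unfolding S(3) by (auto simp: split_beta)
    then have "p \<in> {z. M (fst (h s) - z) \<le> snd (h s)}" using h by blast
    then show "p \<in> V" using s(1) by (auto simp: V_def split_beta)
  qed
  ultimately show ?thesis by (rule that)
qed

text \<open>If every outside point can be separated, the intersection of all finite unions
  containing \<open>C\<close> is \<open>C\<close> itself.\<close>

lemma ball_generated_iff:
  "ball_generated N C \<longleftrightarrow> (\<forall>z. z \<notin> C \<longrightarrow> (\<exists>U\<in>finite_ball_unions N. C \<subseteq> U \<and> z \<notin> U))"
proof
  assume "ball_generated N C"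
  then show "\<forall>z. z \<notin> C \<longrightarrow> (\<exists>U\<in>finite_ball_unions N. C \<subseteq> U \<and> z \<notin> U)"
    unfolding ball_generated_def by blast
next
  assume "\<forall>z. z \<notin> C \<longrightarrow> (\<exists>U\<in>finite_ball_unions N. C \<subseteq> U \<and> z \<notin> U)"
  then have "\<Inter>{U \<in> finite_ball_unions N. C \<subseteq> U} = C" by blast
  then show "ball_generated N C"
    unfolding ball_generated_def by (metis (no_types, lifting) mem_Collect_eq subsetI)
qed

text \<open>The BGP is applied to the part of a half-space inside \<open>cball x R\<close>. This
  part is closed because the bound by the norm makes \<open>f\<close> continuous, and it misses
  \<open>x\<close> because \<open>d\<close> is positive.\<close>

lemma BGP_norm_cover_halfspace:
  fixes x :: "'a::real_normed_vector" and f :: "'a \<Rightarrow> real"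
  assumes "BGP (norm :: 'a \<Rightarrow> real)" "linear f" "\<And>u. f u \<le> norm u" "0 < d"
  obtains U where "U \<in> finite_ball_unions norm" "x \<notin> U"
    "\<And>u. d \<le> f (u - x) \<Longrightarrow> norm (u - x) \<le> R \<Longrightarrow> u \<in> U"
proof -
  define C where "C = {u. d + f x \<le> f u} \<inter> cball x R"
  have "\<bar>f u\<bar> \<le> norm u" for u
    using assms(3)[of u] assms(3)[of "- u"] linear_neg[OF assms(2), of u] by simp
  then have "bounded_linear f"
    using assms(2) by (intro bounded_linear_intro[where K = 1]) (auto simp: linear_add linear_scale)
  then have "closed {u. d + f x \<le> f u}"
    by (intro closed_Collect_le continuous_on_const linear_continuous_on)
  then have "closed C" by (simp add: C_def closed_Int)
  moreover have "bounded C" by (auto simp: C_def intro: bounded_Int)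
  moreover have "convex {u. d + f x \<le> f u}"
  proof -
    have "{u. d + f x \<le> f u} = f -` {d + f x..}" by auto
    then show ?thesis using convex_linear_vimage[OF assms(2)] by simp
  qed
  then have "convex C" by (auto simp: C_def intro: convex_Int)
  ultimately have "ball_generated norm C"
    using assms(1) by (simp add: BGP_def norm_dist_norm)
  moreover have "x \<notin> C" using assms(4) by (simp add: C_def)
  ultimately obtain U where U: "U \<in> finite_ball_unions norm" "C \<subseteq> U" "x \<notin> U"
    unfolding ball_generated_iff by blast
  show ?thesis
  proof (rule that[OF U(1,3)])
    fix u assume "d \<le> f (u - x)" "norm (u - x) \<le> R"
    then have "u \<in> C"
      by (simp add: C_def linear_diff[OF assms(2)] dist_norm norm_minus_commute)
    then show "u \<in> U" using U(2) by blast
  qed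
qed

section \<open>Enlarging balls\<close>

text \<open>The derivative of an even function at 0 vanishes, and the expression is \<open>K\<close>
  times the difference quotient of \<open>h\<close> at \<open>K / s\<close>, which tends to
  0.\<close>

lemma even_derivative_scaled:
  fixes h :: "real \<Rightarrow> real"
  assumes lim: "((\<lambda>t. (h t - h 0) / t) \<longlongrightarrow> D) (at 0)" and even: "\<And>t. h (- t) = h t" and K: "0 < K"
  shows "((\<lambda>s. s * h (K / s) - s * h 0) \<longlongrightarrow> 0) at_top"
proof -
  have "((\<lambda>t. (h (- t) - h 0) / (- t)) \<longlongrightarrow> D) (at 0)"
    using filterlim_compose[OF lim, of uminus "at 0"]
    by (simp add: filterlim_def filtermap_at_minus)
  then have "((\<lambda>t. - ((h t - h 0) / t)) \<longlongrightarrow> D) (at 0)" by (simp add: even)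
  moreover have "((\<lambda>t. - ((h t - h 0) / t)) \<longlongrightarrow> - D) (at 0)"
    by (intro tendsto_minus lim)
  ultimately have "D = - D" using LIM_unique by blast
  then have D: "D = 0" by simp
  have "((\<lambda>s. K / s) \<longlongrightarrow> 0) at_top"
    by (rule real_tendsto_divide_at_top[OF tendsto_const filterlim_ident])
  then have "filterlim (\<lambda>s. K / s) (at 0) at_top"
    using K by (auto simp: filterlim_at intro: eventually_mono[OF eventually_gt_at_top[of 0]])
  then have "((\<lambda>s. (h (K / s) - h 0) / (K / s)) \<longlongrightarrow> 0) at_top"
    using filterlim_compose[OF lim] D by blast
  then have "((\<lambda>s. K * ((h (K / s) - h 0) / (K / s))) \<longlongrightarrow> K * 0) at_top"
    by (rule tendsto_mult_left)
  moreover have "(\<lambda>s. K * ((h (K / s) - h 0) / (K / s))) = (\<lambda>s. s * h (K / s) - s * h 0)"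
    using K by (simp add: fun_eq_iff) (simp add: algebra_simps)
  ultimately show ?thesis by simp
qed

text \<open>Here \<open>G a b\<close> stands for \<open>E (a, b)\<close> or \<open>E (b, a)\<close>.\<close>

lemma enlarge_ball:
  fixes x c :: "'a::real_normed_vector" and G :: "real \<Rightarrow> real \<Rightarrow> real"
  assumes mono: "\<And>a a' b b'. 0 \<le> a \<Longrightarrow> a \<le> a' \<Longrightarrow> 0 \<le> b \<Longrightarrow> b \<le> b' \<Longrightarrow> G a b \<le> G a' b'"
    and lim: "((\<lambda>s. G s R - s) \<longlongrightarrow> 0) at_top"
    and r: "0 < r" "x \<notin> cball c r"
  obtains w \<rho> where "0 < \<rho>" "\<rho> < norm (w - x)"
    "\<And>u b. u \<in> cball c r \<Longrightarrow> 0 \<le> b \<Longrightarrow> b \<le> R \<Longrightarrow> G (norm (w - u)) b \<le> \<rho>"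
proof -
  define e where "e = norm (c - x)"
  have e: "r < e" using r by (simp add: e_def dist_norm)
  \<comment> \<open>The slack \<open>e - r\<close> is the distance of \<open>x\<close> from the
    ball; for large \<open>s\<close> the excess of \<open>G s R\<close> over \<open>s\<close> stays
    below it.\<close>
  have "eventually (\<lambda>s. G s R - s < e - r) at_top"
    using order_tendstoD(2)[OF lim, of "e - r"] e by simp
  then obtain s where s: "r < s" "G s R - s < e - r"
    using eventually_happens'[OF _ eventually_conj[OF eventually_gt_at_top[of r]]]
      trivial_limit_at_top_linorder by blast
  \<comment> \<open>With this \<open>l\<close>, moving the centre by \<open>l * e\<close> away from
    \<open>x\<close> lets the radius grow from \<open>r\<close> to exactly \<open>s\<close>.\<close>
  define l where "l = (s - r) / e"
  have l: "0 < l" "r + l * e = s" using s r e by (auto simp: l_def)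
  define w where "w = c + l *\<^sub>R (c - x)"
  \<comment> \<open>A midpoint, hence strictly below the distance \<open>s + e - r\<close> of the
    new centre from \<open>x\<close>; the maximum with \<open>r\<close> makes it positive.\<close>
  define \<rho> where "\<rho> = (max (G s R) r + (s + e - r)) / 2"
  have "max (G s R) r < s + e - r" using s e r by auto
  then have \<rho>: "max (G s R) r < \<rho>" "\<rho> < s + e - r" by (auto simp: \<rho>_def field_simps)
  have "w - x = (1 + l) *\<^sub>R (c - x)" by (simp add: w_def algebra_simps)
  then have "norm (w - x) = (1 + l) * e" using l by (simp add: e_def)
  also have "\<dots> = s + e - r" using l(2) by (simp add: algebra_simps)
  finally have 1: "norm (w - x) = s + e - r" .
  show ?thesis
  proof (rule that)
    show "0 < \<rho>" using \<rho> r by simp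
    show "\<rho> < norm (w - x)" using \<rho> 1 by simp
    fix u b assume u: "u \<in> cball c r" and b: "0 \<le> b" "b \<le> R"
    have w: "w - u = (c - u) + l *\<^sub>R (c - x)" by (simp add: w_def)
    have "norm (w - u) \<le> norm (c - u) + l * e"
      unfolding w using norm_triangle_ineq[of "c - u" "l *\<^sub>R (c - x)"] l by (simp add: e_def)
    also have "\<dots> \<le> s" using u l(2) by (simp add: dist_norm)
    finally have "G (norm (w - u)) b \<le> G s R" using b by (intro mono) auto
    then show "G (norm (w - u)) b \<le> \<rho>" using \<rho> by simp
  qed
qed

section \<open>Absolute norms on the plane and their derivatives on the axes\<close>

lemma absolute_norm_mono:
  assumes "is_norm E" "absolute E" "0 \<le> a" "a \<le> a'" "0 \<le> b" "b \<le> b'"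
  shows "E (a, b) \<le> E (a', b')"
  using absolute_norm_mono_fst[OF assms(1,2), of a a' b]
    absolute_norm_mono_snd[OF assms(1,2), of b b' a'] assms by linarith

lemma is_norm_scaleR: "is_norm N \<Longrightarrow> N (c *\<^sub>R x) = \<bar>c\<bar> * N x"
  by (simp add: is_norm_def)

lemma absolute_normalised_axes:
  assumes "is_norm E" "absolute E" "normalised E"
  shows "E (a, 0) = \<bar>a\<bar>" "E (0, a) = \<bar>a\<bar>"
  using is_norm_scaleR[OF assms(1), of a "(1, 0)"] is_norm_scaleR[OF assms(1), of a "(0, 1)"] assms(3)
  by (auto simp: normalised_def)

text \<open>Absoluteness makes \<open>E (1, t)\<close> even in \<open>t\<close>, so its derivative
  at 0 vanishes; homogeneity turns \<open>s * E (1, K / s)\<close> into \<open>E (s, K)\<close> for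
  positive \<open>s\<close>.\<close>

lemma gateaux_fst_limit:
  assumes E: "is_norm E" "absolute E" "normalised E" and "gateaux_differentiable_at E (1, 0)" "0 < K"
  shows "((\<lambda>s. E (s, K) - s) \<longlongrightarrow> 0) at_top"
proof -
  obtain D :: "real \<times> real \<Rightarrow> real"
    where "((\<lambda>t. (E ((1, 0) + t *\<^sub>R (0, 1)) - E (1, 0)) / t) \<longlongrightarrow> D (0, 1)) (at 0)"
    using assms(4) unfolding gateaux_differentiable_at_def by blast
  then have "((\<lambda>s. s * E (1, K / s) - s * E (1, 0)) \<longlongrightarrow> 0) at_top"
    using E(2) assms(5) unfolding absolute_def
    by (intro even_derivative_scaled[where h = "\<lambda>t. E (1, t)" and D = "D (0, 1)"])
      (simp, metis abs_minus_cancel, simp)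
  then show ?thesis
  proof (rule Lim_transform_eventually)
    show "\<forall>\<^sub>F s in at_top. s * E (1, K / s) - s * E (1, 0) = E (s, K) - s"
      using eventually_gt_at_top[of 0]
    proof eventually_elim
      case (elim s)
      then show ?case
        using is_norm_scaleR[OF E(1), of s "(1, K / s)"] E(3) by (simp add: normalised_def)
    qed
  qed
qed

lemma gateaux_snd_limit:
  assumes E: "is_norm E" "absolute E" "normalised E" and "gateaux_differentiable_at E (0, 1)" "0 < K"
  shows "((\<lambda>s. E (K, s) - s) \<longlongrightarrow> 0) at_top"
proof -
  obtain D :: "real \<times> real \<Rightarrow> real"
    where "((\<lambda>t. (E ((0, 1) + t *\<^sub>R (1, 0)) - E (0, 1)) / t) \<longlongrightarrow> D (1, 0)) (at 0)"
    using assms(4) unfolding gateaux_differentiable_at_def by blast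
  then have "((\<lambda>s. s * E (K / s, 1) - s * E (0, 1)) \<longlongrightarrow> 0) at_top"
    using E(2) assms(5) unfolding absolute_def
    by (intro even_derivative_scaled[where h = "\<lambda>t. E (t, 1)" and D = "D (1, 0)"])
      (simp, metis abs_minus_cancel, simp)
  then show ?thesis
  proof (rule Lim_transform_eventually)
    show "\<forall>\<^sub>F s in at_top. s * E (K / s, 1) - s * E (0, 1) = E (K, s) - s"
      using eventually_gt_at_top[of 0]
    proof eventually_elim
      case (elim s)
      then show ?case
        using is_norm_scaleR[OF E(1), of s "(K / s, 1)"] E(3) by (simp add: normalised_def)
    qed
  qed
qed

section \<open>Covering a convex set in the direct sum\<close>

theorem corollary3p5:
  fixes E :: "real \<times> real \<Rightarrow> real"
  assumes "is_norm E" and "absolute E" and "normalised E"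
    and "gateaux_differentiable_at E (0, 1)"
    and "gateaux_differentiable_at E (1, 0)"
    and "BGP (norm :: 'a::banach \<Rightarrow> real)"
    and "BGP (norm :: 'b::banach \<Rightarrow> real)"
  shows "BGP (sum_norm E :: 'a \<times> 'b \<Rightarrow> real)"
  unfolding BGP_def ball_generated_iff
proof (intro allI impI, elim conjE)
  let ?N = "sum_norm E :: 'a \<times> 'b \<Rightarrow> real"
  note E = assms(1,2)
  note axes = absolute_normalised_axes[OF assms(1-3)]
  have N: "is_norm ?N" by (rule is_norm_sum_norm[OF E])
  interpret Metric_space UNIV "norm_dist ?N" by (rule Metric_space_norm_dist[OF N])
  have norm: "is_norm (norm :: 'a \<Rightarrow> real)" "is_norm (norm :: 'b \<Rightarrow> real)"
    by (auto simp: is_norm_def norm_triangle_ineq)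
  have coord: "norm (fst p) \<le> ?N p" "norm (snd p) \<le> ?N p" for p
    using absolute_norm_mono[OF E, of "norm (fst p)" "norm (fst p)" 0 "norm (snd p)"]
      absolute_norm_mono[OF E, of 0 "norm (fst p)" "norm (snd p)" "norm (snd p)"]
    by (auto simp: axes sum_norm_def)
  fix C z assume C: "closedin mtopology C" "mbounded C" "convex C" and z: "z \<notin> C"
  obtain x y where xy: "z = (x, y)" by (cases z)
  show "\<exists>W\<in>finite_ball_unions ?N. C \<subseteq> W \<and> z \<notin> W"
  proof (cases "C = {}")
    case True
    \<comment> \<open>The empty union covers the empty set, to which the separation lemma does not
      apply.\<close>
    have "{} \<in> finite_ball_unions ?N"
      unfolding finite_ball_unions_iff[OF N] by (rule exI[of _ "{}"]) auto
    then show ?thesis using True by blast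
  next
    case False
    obtain d where d: "0 < d" "\<And>c. c \<in> C \<Longrightarrow> d \<le> ?N (c - z)"
    proof -
      obtain d where d: "0 < d" "disjnt C (mball z d)"
        using C(1) z unfolding closedin_metric by blast
      have "d \<le> ?N (c - z)" if "c \<in> C" for c
      proof -
        have "c \<notin> mball z d" using d(2) that by (auto simp: disjnt_def)
        then show ?thesis using commute[of z c] by (simp add: norm_dist_def)
      qed
      then show ?thesis using d(1) by (intro that)
    qed
    obtain R where R: "0 < R" "\<And>c. c \<in> C \<Longrightarrow> ?N (c - z) \<le> R"
    proof -
      obtain a B where B: "C \<subseteq> mcball a B"
        using C(2) unfolding mbounded_def by blast
      \<comment> \<open>The maximum with 1 makes \<open>R\<close> positive, as the limit lemmas
        require.\<close>
      have "?N (c - z) \<le> max 1 (B + norm_dist ?N a z)" if "c \<in> C" for c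
      proof -
        have "norm_dist ?N a c \<le> B" using B that by auto
        then have "norm_dist ?N c z \<le> B + norm_dist ?N a z"
          using triangle[of c a z] commute[of c a] by simp
        then show ?thesis unfolding norm_dist_def by linarith
      qed
      then show ?thesis by (intro that[of "max 1 (B + norm_dist ?N a z)"]) auto
    qed
    obtain f where f: "linear f" "f \<le> ?N" "\<And>c. c \<in> C \<Longrightarrow> d \<le> f (c - z)"
      using norm_separation[OF N C(3) False d(2)] by blast
    \<comment> \<open>As \<open>E\<close> is normalised, \<open>sum_norm E\<close> restricts to the
      original norms on the two factors.\<close>
    have f1: "linear (\<lambda>u. f (u, 0))" "\<And>u. f (u, 0) \<le> norm u"
      and f2: "linear (\<lambda>v. f (0, v))" "\<And>v. f (0, v) \<le> norm v"
    proof -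
      show "linear (\<lambda>u. f (u, 0))"
        using linear_add[OF f(1), of "(_, 0)" "(_, 0)"] linear_scale[OF f(1), of _ "(_, 0)"]
        by (intro linearI) auto
      show "linear (\<lambda>v. f (0, v))"
        using linear_add[OF f(1), of "(0, _)" "(0, _)"] linear_scale[OF f(1), of _ "(0, _)"]
        by (intro linearI) auto
      show "f (u, 0) \<le> norm u" for u
        using le_funD[OF f(2), of "(u, 0)"] by (simp add: sum_norm_def axes)
      show "f (0, v) \<le> norm v" for v
        using le_funD[OF f(2), of "(0, v)"] by (simp add: sum_norm_def axes)
    qed
    \<comment> \<open>The gap is halved because \<open>d \<le> f (u - x, 0) + f (0, v - y)\<close>
      on \<open>C\<close> leaves at least \<open>d / 2\<close> to one summand.\<close>
    obtain U1 where U1: "U1 \<in> finite_ball_unions norm" "x \<notin> U1"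
        "\<And>u. d / 2 \<le> f (u - x, 0) \<Longrightarrow> norm (u - x) \<le> R \<Longrightarrow> u \<in> U1"
      using BGP_norm_cover_halfspace[OF assms(6) f1, of "d / 2"] d(1) by (metis half_gt_zero)
    obtain U2 where U2: "U2 \<in> finite_ball_unions norm" "y \<notin> U2"
        "\<And>v. d / 2 \<le> f (0, v - y) \<Longrightarrow> norm (v - y) \<le> R \<Longrightarrow> v \<in> U2"
      using BGP_norm_cover_halfspace[OF assms(7) f2, of "d / 2"] d(1) by (metis half_gt_zero)
    obtain V1 where V1: "V1 \<in> finite_ball_unions ?N" "z \<notin> V1"
        "fst -` U1 \<inter> {p. norm (y - snd p) \<le> R} \<subseteq> V1"
    proof (rule finite_ball_unions_transfer[OF norm(1) N U1(1)])
      fix c :: 'a and r :: real assume r: "0 < r" "{u. norm (c - u) \<le> r} \<subseteq> U1"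
      then have "x \<notin> cball c r" using U1(2) by (auto simp: dist_norm)
      then obtain w \<rho> where "0 < \<rho>" "\<rho> < norm (w - x)"
        "\<And>u b. u \<in> cball c r \<Longrightarrow> 0 \<le> b \<Longrightarrow> b \<le> R \<Longrightarrow> E (norm (w - u), b) \<le> \<rho>"
        using absolute_norm_mono[OF E] gateaux_fst_limit[OF assms(1-3,5) R(1)] r(1)
        by (elim enlarge_ball[where G = "\<lambda>a b. E (a, b)" and R = R, rotated 3]) auto
      \<comment> \<open>The centre \<open>(w, y)\<close> shares its second coordinate with
        \<open>z\<close>, so its distance from \<open>z\<close> is \<open>norm (w - x)\<close>,
        which exceeds \<open>\<rho>\<close>. On the strip the second coordinate differs from
        \<open>y\<close> by at most \<open>R\<close> in norm, as the enlarged ball allows.\<close>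
      then show "\<exists>w \<rho>. 0 < \<rho> \<and> z \<notin> {p. ?N (w - p) \<le> \<rho>} \<and>
          fst -` {u. norm (c - u) \<le> r} \<inter> {p. norm (y - snd p) \<le> R} \<subseteq> {p. ?N (w - p) \<le> \<rho>}"
        by (intro exI[of _ "(w, y)"] exI[of _ \<rho>]) (auto simp: sum_norm_def xy axes dist_norm)
    qed
    obtain V2 where V2: "V2 \<in> finite_ball_unions ?N" "z \<notin> V2"
        "snd -` U2 \<inter> {p. norm (x - fst p) \<le> R} \<subseteq> V2"
    proof (rule finite_ball_unions_transfer[OF norm(2) N U2(1)])
      fix c :: 'b and r :: real assume r: "0 < r" "{v. norm (c - v) \<le> r} \<subseteq> U2"
      then have "y \<notin> cball c r" using U2(2) by (auto simp: dist_norm)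
      then obtain w \<rho> where "0 < \<rho>" "\<rho> < norm (w - y)"
        "\<And>v b. v \<in> cball c r \<Longrightarrow> 0 \<le> b \<Longrightarrow> b \<le> R \<Longrightarrow> E (b, norm (w - v)) \<le> \<rho>"
        using absolute_norm_mono[OF E] gateaux_snd_limit[OF assms(1-4) R(1)] r(1)
        by (elim enlarge_ball[where G = "\<lambda>a b. E (b, a)" and R = R, rotated 3]) auto
      then show "\<exists>w \<rho>. 0 < \<rho> \<and> z \<notin> {p. ?N (w - p) \<le> \<rho>} \<and>
          snd -` {v. norm (c - v) \<le> r} \<inter> {p. norm (x - fst p) \<le> R} \<subseteq> {p. ?N (w - p) \<le> \<rho>}"
        by (intro exI[of _ "(x, w)"] exI[of _ \<rho>]) (auto simp: sum_norm_def xy axes dist_norm)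
    qed
    have "c \<in> V1 \<union> V2" if c: "c \<in> C" for c
    proof -
      obtain u v where uv: "c = (u, v)" by (cases c)
      have "norm (u - x) \<le> R" "norm (v - y) \<le> R"
        using coord[of "c - z"] R(2)[OF c] by (auto simp: uv xy)
      moreover have "d \<le> f (u - x, 0) + f (0, v - y)"
        using f(3)[OF c] linear_add[OF f(1), of "(u - x, 0)" "(0, v - y)"] by (simp add: uv xy)
      then have "d / 2 \<le> f (u - x, 0) \<or> d / 2 \<le> f (0, v - y)" by linarith
      ultimately have "u \<in> U1 \<and> norm (y - v) \<le> R \<or> v \<in> U2 \<and> norm (x - u) \<le> R"
        using U1(3)[of u] U2(3)[of v] by (metis norm_minus_commute)
      then show ?thesis
        using subsetD[OF V1(3), of "(u, v)"] subsetD[OF V2(3), of "(u, v)"] by (auto simp: uv)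
    qed
    then show ?thesis
      using finite_ball_unions_Un[OF N V1(1) V2(1)] V1(2) V2(2) by blast
  qed
qed

end
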